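(* Let $n\ge1$, $v_i=(i,1)\in N=\mathbb{Z}^2$ for $0\le i\le n$, and let $C$ be the cone with rays through $v_0$ and $v_n$. For any pair of solutions $\Phi=(\Phi_c)_{c\in C\cap N}$ of $bbGKZ(C,0)$ and $\Psi=(\Psi_d)_{d\in C^\circ\cap N}$ of $bbGKZ(C^\circ,0)$, the function of $(x_0,\dots,x_n)$ $$\langle\Phi,\Psi\rangle=\Phi_{(0,0)}\sum_{0\le i<j\le n}(j-i)^2x_ix_j\Psi_{v_i+v_j}-\sum_{0\le i<j\le n}n(j-i)x_ix_j\sum_{\substack{c+d=v_i+v_j\\ c,d\in\sigma_{ij},\ \deg c=1}}\delta_{ij}^c\,\Phi_c\Psi_d$$ is a constant.
   Context: $bbGKZ(C,0)$ is the system for collections $(\Phi_c)$ of functions of $(x_0,\dots,x_n)$ indexed by lattice points $c\in C$: $\partial_i\Phi_c=\Phi_{c+v_i}$ for $0\le i\le n$, and $\sum_{i=0}^n\mu(v_i)x_i\partial_i\Phi_c+\mu(c)\Phi_c=0$ for all linear functions $\mu\in N^\vee$. $bbGKZ(C^\circ,0)$ is the same system for collections $(\Psi_d)$ indexed by lattice points $d$ in the interior $C^\circ$ of $C$. Solutions are holomorphic on a connected open subset of the nondegenerate locus, i.e. the set of $(x_0,\dots,x_n)\in\mathbb{C}^{n+1}$ such that $x_0\ne0$, $x_n\ne0$ and $f(z)=x_0+x_1z+\dots+x_nz^n$ has $n$ distinct roots. For $i<j$, $\sigma_{ij}$ is the cone generated by $v_i$ and $v_j$. The degree of a lattice point $(k,l)$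 is $l$. In the inner sum, $c,d$ are lattice points and only terms with $d\in C^\circ$ are taken. $\delta_{ij}^c=1$ if $c$ lies in the interior of $\sigma_{ij}$ and $\delta_{ij}^c=\frac12$ otherwise. *)

theory Defs
  imports "HOL-Analysis.Analysis"
begin

text \<open>
  The lattice is \<open>N = int \<times> int\<close>, and \<open>C^{n+1}\<close> is \<open>complex ^ 'm\<close>
  together with a labelling \<open>e :: nat \<Rightarrow> 'm\<close> of its coordinates, a bijection from
  \<open>{0..n}\<close> onto the whole index type. The coordinate \<open>x_i\<close> is \<open>x $ e i\<close>.
\<close>

type_synonym lattice = "int \<times> int"

definition lat_real :: "lattice \<Rightarrow> real \<times> real"
  where "lat_real c = (of_int (fst c), of_int (snd c))"

definition lat_deg :: "lattice \<Rightarrow> int"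
  where "lat_deg c = snd c"

definition v :: "nat \<Rightarrow> lattice"
  where "v i = (int i, 1)"

definition sigma :: "nat \<Rightarrow> nat \<Rightarrow> (real \<times> real) set"
  where "sigma i j = convex_cone hull {lat_real (v i), lat_real (v j)}"

definition lat_points :: "(real \<times> real) set \<Rightarrow> lattice set"
  where "lat_points S = {c. lat_real c \<in> S}"

definition cone_C :: "nat \<Rightarrow> (real \<times> real) set"
  where "cone_C n = convex_cone hull {lat_real (v 0), lat_real (v n)}"

text \<open>Holomorphic in several variables: at every point the (real) Frechet derivative
  exists and is complex linear.\<close>

definition holomorphic_several :: "(complex ^ 'm::finite) set \<Rightarrow> (complex ^ 'm \<Rightarrow> complex) \<Rightarrow> bool"
  where "holomorphic_several U f \<longleftrightarrow>
    (\<forall>x\<in>U. \<exists>D. (f has_derivative D) (at x) \<and> (\<forall>a w. D (a *s w) = a * D w))"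

definition partial_deriv ::
    "(nat \<Rightarrow> 'm::finite) \<Rightarrow> nat \<Rightarrow> (complex ^ 'm \<Rightarrow> complex) \<Rightarrow> complex ^ 'm \<Rightarrow> complex"
  where "partial_deriv e i f x = deriv (\<lambda>t. f (x + axis (e i) t)) 0"

definition nondeg_locus :: "(nat \<Rightarrow> 'm::finite) \<Rightarrow> nat \<Rightarrow> (complex ^ 'm) set"
  where "nondeg_locus e n =
    {x. x $ e 0 \<noteq> 0 \<and> x $ e n \<noteq> 0 \<and> card {z::complex. (\<Sum>i=0..n. x $ e i * z ^ i) = 0} = n}"

text \<open>The system for collections indexed by a set \<open>S\<close> of lattice points; it is
  \<open>bbGKZ(C,0)\<close> for \<open>S = lat_points (cone_C n)\<close> and \<open>bbGKZ(C\<degree>,0)\<close> for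
  \<open>S = lat_points (interior (cone_C n))\<close>. A collection is a function on the whole lattice,
  of which only the values on \<open>S\<close> matter.\<close>

definition bbGKZ_solution ::
    "(nat \<Rightarrow> 'm::finite) \<Rightarrow> nat \<Rightarrow> lattice set \<Rightarrow> (complex ^ 'm) set
      \<Rightarrow> (lattice \<Rightarrow> complex ^ 'm \<Rightarrow> complex) \<Rightarrow> bool"
  where "bbGKZ_solution e n S U \<Phi> \<longleftrightarrow>
    (\<forall>c\<in>S. holomorphic_several U (\<Phi> c)) \<and>
    (\<forall>c\<in>S. \<forall>i\<le>n. \<forall>x\<in>U. partial_deriv e i (\<Phi> c) x = \<Phi> (c + v i) x) \<and>
    (\<forall>\<mu>::lattice \<Rightarrow> int. Modules.additive \<mu> \<longrightarrow> (\<forall>c\<in>S. \<forall>x\<in>U.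
       (\<Sum>i=0..n. of_int (\<mu> (v i)) * x $ e i * partial_deriv e i (\<Phi> c) x)
         + of_int (\<mu> c) * \<Phi> c x = 0))"

definition delta :: "nat \<Rightarrow> nat \<Rightarrow> lattice \<Rightarrow> complex"
  where "delta i j c = (if lat_real c \<in> interior (sigma i j) then 1 else 1 / 2)"

definition inner_index :: "nat \<Rightarrow> nat \<Rightarrow> nat \<Rightarrow> (lattice \<times> lattice) set"
  where "inner_index n i j =
    {(c, d). c + d = v i + v j \<and> c \<in> lat_points (sigma i j) \<and> d \<in> lat_points (sigma i j)
       \<and> lat_deg c = 1 \<and> d \<in> lat_points (interior (cone_C n))}"

definition pairing ::
    "(nat \<Rightarrow> 'm::finite) \<Rightarrow> nat \<Rightarrow> (lattice \<Rightarrow> complex ^ 'm \<Rightarrow> complex)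
      \<Rightarrow> (lattice \<Rightarrow> complex ^ 'm \<Rightarrow> complex) \<Rightarrow> complex ^ 'm \<Rightarrow> complex"
  where "pairing e n \<Phi> \<Psi> x =
    \<Phi> (0, 0) x *
      (\<Sum>(i, j) \<in> {(i, j). i < j \<and> j \<le> n}.
         (of_nat j - of_nat i)\<^sup>2 * x $ e i * x $ e j * \<Psi> (v i + v j) x)
    - (\<Sum>(i, j) \<in> {(i, j). i < j \<and> j \<le> n}.
         of_nat n * (of_nat j - of_nat i) * x $ e i * x $ e j *
           (\<Sum>(c, d) \<in> inner_index n i j. delta i j c * \<Phi> c x * \<Psi> d x))"

text \<open>The sums in \<open>pairing\<close> range over finite sets, so none of them is zero by convention.\<close>

lemma finite_outer_index: "finite {(i, j). i < j \<and> j \<le> (n::nat)}"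
  by (rule finite_subset[of _ "{0..n} \<times> {0..n}"]) auto

lemma finite_inner_index:
  assumes "i \<le> j"
  shows "finite (inner_index n i j)"
proof -
  let ?K = "{p :: real \<times> real. real i * snd p \<le> fst p \<and> fst p \<le> real j * snd p}"
  have "convex_cone ?K"
  proof -
    have "real i * (a * s) \<le> a * r \<and> a * r \<le> real j * (a * s)"
      if "0 \<le> a" "real i * s \<le> r" "r \<le> real j * s" for a r s :: real
      using mult_left_mono[OF that(2,1)] mult_left_mono[OF that(3,1)] by (simp add: ac_simps)
    then show ?thesis
      unfolding convex_cone_iff by (fastforce simp: distrib_left)
  qed
  moreover have "{lat_real (v i), lat_real (v j)} \<subseteq> ?K"
    using assms by (auto simp: lat_real_def v_def)
  ultimately have sub: "sigma i j \<subseteq> ?K"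
    unfolding sigma_def by (rule hull_minimal[rotated])
  have "inner_index n i j \<subseteq> (\<lambda>k. ((k, 1), v i + v j - (k, 1))) ` {int i..int j}"
  proof
    fix p assume "p \<in> inner_index n i j"
    then obtain k d where p: "p = ((k, 1), d)" and s: "(k, 1) + d = v i + v j"
      and "lat_real (k, 1) \<in> sigma i j"
      by (auto simp: inner_index_def lat_points_def lat_deg_def)
    with sub have "real_of_int k \<in> {real i..real j}"
      by (auto simp: lat_real_def)
    then have "k \<in> {int i..int j}"
      by auto
    moreover have "d = v i + v j - (k, 1)"
      using s by (metis add_diff_cancel_left')
    ultimately show "p \<in> (\<lambda>k. ((k, 1), v i + v j - (k, 1))) ` {int i..int j}"
      using p by blast
  qed
  then show ?thesis
    by (rule finite_subset) simp
qed

end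

theory Submission
  imports Defs
begin

text \<open>
  The pairing is constant because all its partial derivatives vanish, and each of them vanishes
  pointwise, by linear algebra. Differentiating in \<open>x\<^sub>m\<close> raises the index of \<open>\<Phi>\<close> or \<open>\<Psi>\<close> by
  \<open>v m\<close>, so at a fixed point the derivative is bilinear in the values
  \<open>F = \<Phi>\<^sub>(\<^sub>0\<^sub>,\<^sub>0\<^sub>)\<close>, \<open>A k = \<Phi>(k,1)\<close>, \<open>B k = \<Phi>(k,2)\<close> of \<open>\<Phi>\<close> and \<open>P k = \<Psi>(k,1)\<close>, \<open>Q k = \<Psi>(k,2)\<close>,
  \<open>R k = \<Psi>(k,3)\<close> of \<open>\<Psi>\<close>. These are tied by the Euler relations
  \<open>\<Sum>\<^sub>j (j - i) x\<^sub>j B (j + p) = (i - p) A p\<close> and their analogues, which may be used only for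
  \<open>p\<close> in the cone (for \<open>\<Phi>\<close>) or in its interior (for \<open>\<Psi>\<close>).

  The inner sum is over \<open>d = v l\<close>, \<open>c = v i + v j - v l\<close>, and its coefficients are captured by
  \<open>between_weight i j l = (sgn (l - i) - sgn (l - j)) / 2\<close>: for \<open>i < j\<close> this is \<open>1\<close> strictly
  between \<open>i\<close> and \<open>j\<close>, \<open>1/2\<close> at the two ends and \<open>0\<close> outside. It is antisymmetric in \<open>i, j\<close>, so
  \<open>(j - i) between_weight i j l\<close> is symmetric and all sums over \<open>i < j\<close> are half of sums over a square.
  It is also a difference \<open>between_weight i m l - between_weight j m l\<close> for every \<open>m\<close>, so
  such a square sum is twice a sum with weight \<open>between_weight i m l\<close>, in which the sum over \<open>j\<close>
  is the left-hand side of an Euler relation with \<open>p = i + m - l\<close>. Taking for \<open>m\<close> the index of the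
  differentiation variable is what makes this work: the weight vanishes unless \<open>l\<close> is between
  \<open>i\<close> and \<open>m\<close>, and then \<open>p\<close> is between them as well, hence in the cone.

  With this, the \<open>m\<close>-th derivative splits into three parts. The part with factor \<open>F\<close> cancels by
  itself (\<open>Phi0_part_vanishes\<close>). The terms in \<open>A P\<close> and \<open>B P\<close> add up to one sum over \<open>A P\<close>
  (\<open>Psi1_part\<close>). The terms in \<open>A Q\<close> give the negative of that sum, except where \<open>p\<close> is on the
  boundary of the cone and \<open>\<Psi>\<close> has no Euler relation (\<open>A_Q_part\<close>); the two boundary contributions
  together are \<open>A m / n\<close> times \<open>\<Sum>\<Sum> (j - i)\<^sup>2 x\<^sub>i x\<^sub>j Q (i + j)\<close> and cancel against the derivative
  of the factor \<open>F\<close> (\<open>square_Q_sum\<close>). This last step fixes the constant \<open>n\<close> in the pairing.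
\<close>

section \<open>Symmetric double sums and the betweenness weight\<close>

lemma sum_sum_symmetrize:
  fixes h :: "'b \<Rightarrow> 'b \<Rightarrow> 'a::comm_semiring_1"
  shows "(\<Sum>i\<in>I. \<Sum>j\<in>I. h i j + h j i) = 2 * (\<Sum>i\<in>I. \<Sum>j\<in>I. h i j)"
proof -
  have "(\<Sum>i\<in>I. \<Sum>j\<in>I. h j i) = (\<Sum>i\<in>I. \<Sum>j\<in>I. h i j)"
    by (rule sum.swap)
  then show ?thesis
    by (simp add: sum.distrib mult_2)
qed

text \<open>
  The factor in parentheses is the derivative of \<open>X i * X j\<close> in the coordinate \<open>X m\<close>.
\<close>
lemma sum_sum_coordinate_derivatives:
  fixes s :: "'b \<Rightarrow> 'b \<Rightarrow> 'a::comm_semiring_1"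
  assumes "finite I" "m \<in> I" and sym: "\<And>i j. s i j = s j i"
  shows "(\<Sum>i\<in>I. \<Sum>j\<in>I. s i j * (of_bool (m = i) * X j + X i * of_bool (m = j)))
       = 2 * (\<Sum>j\<in>I. s m j * X j)"
proof -
  let ?h = "\<lambda>i j. if m = i then s i j * X j else 0"
  have "(\<Sum>i\<in>I. \<Sum>j\<in>I. s i j * (of_bool (m = i) * X j + X i * of_bool (m = j)))
      = (\<Sum>i\<in>I. \<Sum>j\<in>I. ?h i j + ?h j i)"
    by (intro sum.cong refl) (auto simp: distrib_left sym)
  also have "\<dots> = 2 * (\<Sum>i\<in>I. \<Sum>j\<in>I. ?h i j)"
    by (rule sum_sum_symmetrize)
  also have "(\<Sum>i\<in>I. \<Sum>j\<in>I. ?h i j) = (\<Sum>j\<in>I. s m j * X j)"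
    using assms by (subst sum.swap) simp
  finally show ?thesis .
qed

definition between_weight :: "int \<Rightarrow> int \<Rightarrow> int \<Rightarrow> 'a::field_char_0"
  where "between_weight i j l = of_int (sgn (l - i) - sgn (l - j)) / 2"

text \<open>
  Reflecting \<open>l\<close> shows that \<open>i + j - l\<close> is between \<open>i\<close> and \<open>j\<close> as well; this keeps the shifted
  indices of \<open>A\<close>, \<open>B\<close> and \<open>Q\<close> inside the cone.
\<close>
lemma between_weight_nonzeroD:
  assumes "between_weight i j l \<noteq> (0::'a::field_char_0)"
  shows "min i j \<le> l" and "l \<le> max i j"
proof -
  have "sgn (l - i) \<noteq> sgn (l - j)"
    using assms by (auto simp: between_weight_def)
  moreover have "sgn (l - i) = sgn (l - j)" if "l < min i j \<or> max i j < l"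
    using that by (elim disjE) simp_all
  ultimately show "min i j \<le> l" and "l \<le> max i j"
    by linarith+
qed

lemma between_weight_reflect: "between_weight i j (i + j - l) = between_weight i j l"
proof -
  have "sgn (i + j - l - i) = - sgn (l - j)" "sgn (i + j - l - j) = - sgn (l - i)"
    by (simp_all add: sgn_if)
  then show ?thesis
    by (simp only: between_weight_def minus_diff_minus minus_diff_eq)
qed

lemma between_weight_diff: "between_weight i j l = between_weight i m l - between_weight j m l"
  by (simp add: between_weight_def field_simps)

lemma between_weight_commute: "between_weight j i l = - between_weight i j l"
  by (simp add: between_weight_def field_simps)

text \<open>
  The reflection \<open>l \<mapsto> i + j - l\<close>, which exchanges the two summands in \<open>c + d = v i + v j\<close>,
  preserves both the weight and its support; outside the support the reflected index may leave
  \<open>{0..N}\<close>, but there the weight is zero.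
\<close>
lemma sum_between_weight_reflect:
  fixes f :: "int \<Rightarrow> int \<Rightarrow> 'a::field_char_0"
  assumes "i \<in> {0..N}" "j \<in> {0..N}"
  shows "(\<Sum>l\<in>{0..N}. between_weight i j l * f l (i + j - l))
       = (\<Sum>l\<in>{0..N}. between_weight i j l * f (i + j - l) l)"
proof -
  let ?w = "between_weight i j :: int \<Rightarrow> 'a"
  have support: "(\<Sum>l\<in>{0..N}. ?w l * g l) = (\<Sum>l\<in>{min i j..max i j}. ?w l * g l)" for g
  proof (rule sum.mono_neutral_right)
    show "\<forall>l\<in>{0..N} - {min i j..max i j}. ?w l * g l = 0"
      by (metis DiffE atLeastAtMost_iff between_weight_nonzeroD mult_zero_left)
  qed (use assms in auto)
  have "(\<Sum>l\<in>{min i j..max i j}. ?w l * f l (i + j - l))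
      = (\<Sum>l\<in>{min i j..max i j}. ?w (i + j - l) * f (i + j - l) l)"
    by (rule sum.reindex_bij_witness[where i = "\<lambda>l. i + j - l" and j = "\<lambda>l. i + j - l"]) auto
  then show ?thesis
    unfolding support between_weight_reflect .
qed

section \<open>The Euler relations at a point imply the vanishing of the derivative\<close>

text \<open>
  The values of the two solutions at one point, graded by degree: \<open>A, B\<close> are those of \<open>\<Phi>\<close> in
  degrees 1 and 2, and \<open>P, Q, R\<close> those of \<open>\<Psi>\<close> in degrees 1, 2 and 3. The assumptions are the Euler
  relations for the linear functions degree and first coordinate; in degree \<open>d\<close> they
  hold at the lattice points \<open>(p, d)\<close> with \<open>0 \<le> p \<le> d * N\<close> for \<open>\<Phi>\<close>, and \<open>0 < p < d * N\<close> for \<open>\<Psi>\<close>.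
\<close>
locale bbGKZ_values_at_point =
  fixes N :: int and X A B P Q R :: "int \<Rightarrow> 'a::field_char_0"
  assumes N: "N \<ge> 1"
    and A_deg: "(\<Sum>j\<in>{0..N}. X j * A j) = 0"
    and A_fst: "(\<Sum>j\<in>{0..N}. of_int j * X j * A j) = 0"
    and B_deg: "p \<in> {0..N} \<Longrightarrow> (\<Sum>j\<in>{0..N}. X j * B (j + p)) = - A p"
    and B_fst: "p \<in> {0..N} \<Longrightarrow> (\<Sum>j\<in>{0..N}. of_int j * X j * B (j + p)) = - of_int p * A p"
    and Q_deg: "p \<in> {1..N-1} \<Longrightarrow> (\<Sum>j\<in>{0..N}. X j * Q (j + p)) = - P p"
    and Q_fst: "p \<in> {1..N-1} \<Longrightarrow> (\<Sum>j\<in>{0..N}. of_int j * X j * Q (j + p)) = - of_int p * P p"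
    and R_deg: "p \<in> {1..2*N-1} \<Longrightarrow> (\<Sum>j\<in>{0..N}. X j * R (j + p)) = - 2 * Q p"
    and R_fst: "p \<in> {1..2*N-1} \<Longrightarrow> (\<Sum>j\<in>{0..N}. of_int j * X j * R (j + p)) = - of_int p * Q p"
begin

lemma A_euler: "(\<Sum>j\<in>{0..N}. of_int (j - i) * X j * A j) = 0"
  using A_deg A_fst
  by (simp add: left_diff_distrib sum_subtractf mult.assoc flip: sum_distrib_left)

lemma B_euler:
  assumes "p \<in> {0..N}"
  shows "(\<Sum>j\<in>{0..N}. of_int (j - i) * X j * B (j + p)) = of_int (i - p) * A p"
  using B_deg[OF assms] B_fst[OF assms]
  by (simp add: left_diff_distrib sum_subtractf mult.assoc flip: sum_distrib_left)

lemma Q_euler: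
  assumes "p \<in> {1..N-1}"
  shows "(\<Sum>j\<in>{0..N}. of_int (j - i) * X j * Q (j + p)) = of_int (i - p) * P p"
  using Q_deg[OF assms] Q_fst[OF assms]
  by (simp add: left_diff_distrib sum_subtractf mult.assoc flip: sum_distrib_left)

lemma R_euler:
  assumes "p \<in> {1..2*N-1}"
  shows "(\<Sum>j\<in>{0..N}. of_int (j - i) * X j * R (j + p)) = of_int (2 * i - p) * Q p"
  using R_deg[OF assms] R_fst[OF assms]
  by (simp add: left_diff_distrib sum_subtractf mult.assoc algebra_simps flip: sum_distrib_left)

text \<open>
  Symmetrizing \<open>(m - i) * (j - i)\<close> in \<open>i, j\<close> gives \<open>(j - i)\<^sup>2\<close>, which brings the double sum into
  Euler form with \<open>p = i + m\<close>. This \<open>p\<close> is on the boundary of the cone only for \<open>i = m\<close>, where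
  the factor \<open>m - i\<close> is zero.
\<close>
lemma Phi0_part_vanishes:
  assumes m: "m \<in> {0..N}"
  shows "2 * (\<Sum>j\<in>{0..N}. of_int ((j - m)\<^sup>2) * X j * Q (j + m))
       + (\<Sum>i\<in>{0..N}. \<Sum>j\<in>{0..N}. of_int ((j - i)\<^sup>2) * X i * X j * R (i + j + m)) = 0"
proof -
  have "(\<Sum>i\<in>{0..N}. \<Sum>j\<in>{0..N}. of_int ((j - i)\<^sup>2) * X i * X j * R (i + j + m))
      = (\<Sum>i\<in>{0..N}. \<Sum>j\<in>{0..N}. of_int ((m - i) * (j - i)) * X i * X j * R (i + j + m)
           + of_int ((m - j) * (i - j)) * X j * X i * R (j + i + m))"
    by (intro sum.cong refl) (simp add: power2_eq_square algebra_simps)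
  also have "\<dots> = 2 * (\<Sum>i\<in>{0..N}. \<Sum>j\<in>{0..N}.
       of_int ((m - i) * (j - i)) * X i * X j * R (i + j + m))"
    by (rule sum_sum_symmetrize)
  also have "\<dots> = 2 * (\<Sum>i\<in>{0..N}. of_int (m - i) * X i *
       (\<Sum>j\<in>{0..N}. of_int (j - i) * X j * R (j + (i + m))))"
    by (simp add: sum_distrib_left mult_ac add_ac)
  also have "\<dots> = 2 * (\<Sum>i\<in>{0..N}. - of_int ((i - m)\<^sup>2) * X i * Q (i + m))"
  proof (intro arg_cong[where f = "(*) 2"] sum.cong refl)
    fix i assume i: "i \<in> {0..N}"
    show "of_int (m - i) * X i * (\<Sum>j\<in>{0..N}. of_int (j - i) * X j * R (j + (i + m)))
        = - of_int ((i - m)\<^sup>2) * X i * Q (i + m)"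
    proof (cases "i = m")
      case False
      then have "i + m \<in> {1..2*N-1}" using i m by auto
      then show ?thesis
        by (subst R_euler) (simp_all add: power2_eq_square algebra_simps)
    qed simp
  qed
  finally show ?thesis
    by (simp add: sum_negf)
qed

text \<open>
  The two sums are the coefficients of \<open>P l\<close> that come from differentiating \<open>A\<close> and from
  differentiating \<open>X i * X j\<close>. Splitting the weight at \<open>m\<close> turns the first into a sum over \<open>A\<close>
  with factor \<open>l - m\<close>; the second has factor \<open>m - i\<close> for the same weight, so they
  combine to \<open>l - i\<close>.
\<close>
lemma Psi1_part:
  assumes m: "m \<in> {0..N}" and l: "l \<in> {0..N}"
  shows "(\<Sum>i\<in>{0..N}. \<Sum>j\<in>{0..N}.
            of_int (j - i) * between_weight i j l * X i * X j * B (i + j - l + m))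
       + 2 * (\<Sum>j\<in>{0..N}. of_int (j - m) * between_weight m j l * X j * A (m + j - l))
       = 2 * (\<Sum>i\<in>{0..N}. of_int (l - i) * between_weight i m l * X i * A (i + m - l))"
proof -
  have "(\<Sum>i\<in>{0..N}. \<Sum>j\<in>{0..N}.
            of_int (j - i) * between_weight i j l * X i * X j * B (i + j - l + m))
      = (\<Sum>i\<in>{0..N}. \<Sum>j\<in>{0..N}.
            of_int (j - i) * between_weight i m l * X i * X j * B (i + j - l + m)
          + of_int (i - j) * between_weight j m l * X j * X i * B (j + i - l + m))"
    by (intro sum.cong refl, subst between_weight_diff[of _ _ _ m]) (simp add: algebra_simps)
  also have "\<dots> = 2 * (\<Sum>i\<in>{0..N}. \<Sum>j\<in>{0..N}.
            of_int (j - i) * between_weight i m l * X i * X j * B (i + j - l + m))"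
    by (rule sum_sum_symmetrize)
  also have "\<dots> = 2 * (\<Sum>i\<in>{0..N}. between_weight i m l * X i *
            (\<Sum>j\<in>{0..N}. of_int (j - i) * X j * B (j + (i + m - l))))"
    by (simp add: sum_distrib_left mult_ac algebra_simps)
  also have "\<dots> = 2 * (\<Sum>i\<in>{0..N}. of_int (l - m) * between_weight i m l * X i * A (i + m - l))"
  proof (intro arg_cong[where f = "(*) 2"] sum.cong refl)
    fix i assume i: "i \<in> {0..N}"
    show "between_weight i m l * X i * (\<Sum>j\<in>{0..N}. of_int (j - i) * X j * B (j + (i + m - l)))
        = of_int (l - m) * between_weight i m l * X i * A (i + m - l)"
    proof (cases "between_weight i m l = (0::'a)")
      case False
      from between_weight_nonzeroD[OF this] have "i + m - l \<in> {0..N}" using i m by auto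
      then show ?thesis
        by (subst B_euler) (simp_all add: algebra_simps)
    qed simp
  qed
  finally have B_terms: "(\<Sum>i\<in>{0..N}. \<Sum>j\<in>{0..N}.
            of_int (j - i) * between_weight i j l * X i * X j * B (i + j - l + m))
      = 2 * (\<Sum>i\<in>{0..N}. of_int (l - m) * between_weight i m l * X i * A (i + m - l))" .
  have "(\<Sum>i\<in>{0..N}. of_int (l - m) * between_weight i m l * X i * A (i + m - l))
      + (\<Sum>j\<in>{0..N}. of_int (j - m) * between_weight m j l * X j * A (m + j - l))
      = (\<Sum>i\<in>{0..N}. of_int (l - i) * between_weight i m l * X i * A (i + m - l))"
    unfolding sum.distrib[symmetric] between_weight_commute[of m]
    by (intro sum.cong refl) (simp add: algebra_simps)
  then show ?thesis
    unfolding B_terms by (simp only: flip: distrib_left)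
qed

lemma sum_split_ends:
  fixes f :: "int \<Rightarrow> 'b::comm_monoid_add"
  shows "(\<Sum>l\<in>{0..N}. f l) = f 0 + f N + (\<Sum>l\<in>{1..N-1}. f l)"
proof -
  have "{0..N} = insert 0 (insert N {1..N-1})" using N by auto
  then show ?thesis using N by (simp add: add.assoc)
qed

text \<open>
  For any \<open>a\<close>, symmetrizing \<open>(a - i) * (j - i)\<close> gives \<open>(j - i)\<^sup>2\<close>, and the Euler relations kill the
  terms with \<open>0 < i < N\<close>. Choosing \<open>a\<close> at one end of \<open>{0..N}\<close> also kills that end, so the sum is
  concentrated at the opposite end \<open>N - a\<close>.
\<close>
lemma square_Q_sum:
  assumes "a \<in> {0, N}"
  shows "(\<Sum>i\<in>{0..N}. \<Sum>j\<in>{0..N}. of_int ((j - i)\<^sup>2) * X i * X j * Q (i + j))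
       = 2 * of_int (2 * a - N) * X (N - a) * (\<Sum>j\<in>{0..N}. of_int (j - (N - a)) * X j * Q (j + (N - a)))"
proof -
  define Y where "Y i = (\<Sum>j\<in>{0..N}. of_int (j - i) * X j * Q (j + i))" for i
  have "(\<Sum>i\<in>{0..N}. \<Sum>j\<in>{0..N}. of_int ((j - i)\<^sup>2) * X i * X j * Q (i + j))
      = (\<Sum>i\<in>{0..N}. \<Sum>j\<in>{0..N}. of_int ((a - i) * (j - i)) * X i * X j * Q (i + j)
           + of_int ((a - j) * (i - j)) * X j * X i * Q (j + i))"
    by (intro sum.cong refl) (simp add: power2_eq_square algebra_simps)
  also have "\<dots> = 2 * (\<Sum>i\<in>{0..N}. \<Sum>j\<in>{0..N}.
       of_int ((a - i) * (j - i)) * X i * X j * Q (i + j))"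
    by (rule sum_sum_symmetrize)
  also have "\<dots> = 2 * (\<Sum>i\<in>{0..N}. of_int (a - i) * X i * Y i)"
    by (simp add: sum_distrib_left mult_ac add_ac Y_def)
  also have "(\<Sum>i\<in>{0..N}. of_int (a - i) * X i * Y i)
     = of_int a * X 0 * Y 0 + of_int (a - N) * X N * Y N"
    using Q_euler by (simp add: sum_split_ends Y_def)
  finally show ?thesis using assms unfolding Y_def by auto
qed

lemma euler_sum_affine:
  "(\<Sum>j\<in>{0..N}. of_int (j - i) * X j * Q (j + p))
     = (\<Sum>j\<in>{0..N}. of_int j * X j * Q (j + p)) - of_int i * (\<Sum>j\<in>{0..N}. X j * Q (j + p))"
  by (simp add: left_diff_distrib sum_subtractf mult.assoc flip: sum_distrib_left)

text \<open>
  The inner sum depends on \<open>i\<close> as an affine function, and both Euler relations for \<open>\<Phi>\<^sub>(\<^sub>0\<^sub>,\<^sub>0\<^sub>)\<close> have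
  right-hand side zero.
\<close>
lemma A_orthogonal_euler_sums:
  "(\<Sum>i\<in>{0..N}. X i * A i * (\<Sum>j\<in>{0..N}. of_int (j - i) * X j * Q (j + p))) = 0"
proof -
  have "(\<Sum>i\<in>{0..N}. X i * A i * (a - of_int i * b)) = 0" for a b
  proof -
    have "(\<Sum>i\<in>{0..N}. X i * A i * (a - of_int i * b))
        = (\<Sum>i\<in>{0..N}. X i * A i) * a - (\<Sum>i\<in>{0..N}. of_int i * X i * A i) * b"
      by (simp only: sum_distrib_left sum_subtractf right_diff_distrib mult_ac)
    then show ?thesis
      by (simp add: A_deg A_fst)
  qed
  then show ?thesis
    by (simp only: euler_sum_affine)
qed

text \<open>
  The contribution of \<open>p = 0\<close> to the terms in \<open>A Q\<close>. If \<open>m > 0\<close>, the weight is zero except at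
  \<open>i = 0\<close>. If \<open>m = 0\<close>, it is \<open>-1/2\<close> except at \<open>i = 0\<close>, and orthogonality replaces the sum over the
  other \<open>i\<close> by minus its term at \<open>i = 0\<close>. Both cases give the same value.
\<close>
lemma lower_end_sum:
  assumes m: "m \<in> {0..N}"
  shows "2 * (\<Sum>i\<in>{0..N}. between_weight i m 0 * A (i + m) * X i *
            (\<Sum>j\<in>{0..N}. of_int (j - i) * X j * Q j))
       = A m * X 0 * (\<Sum>j\<in>{0..N}. of_int j * X j * Q j)"
proof -
  define y where "y i = (\<Sum>j\<in>{0..N}. of_int (j - i) * X j * Q j)" for i
  have orth: "(\<Sum>i\<in>{0..N}. X i * A i * y i) = 0"
    using A_orthogonal_euler_sums[of 0] by (simp add: y_def)
  have I: "{0..N} = insert 0 {1..N}" using N by auto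
  have "2 * (\<Sum>i\<in>{0..N}. between_weight i m 0 * A (i + m) * X i * y i) = A m * X 0 * y 0"
  proof (cases "m = 0")
    case True
    have "(\<Sum>i\<in>{1..N}. between_weight i m 0 * A (i + m) * X i * y i)
        = (\<Sum>i\<in>{1..N}. - (X i * A i * y i) / 2)"
      by (intro sum.cong refl) (simp add: True between_weight_def)
    also have "\<dots> = - (\<Sum>i\<in>{1..N}. X i * A i * y i) / 2"
      by (simp add: sum_negf sum_divide_distrib)
    finally show ?thesis
      using orth by (simp add: I True between_weight_def add_eq_0_iff2 mult_ac)
  next
    case False
    have "(\<Sum>i\<in>{1..N}. between_weight i m 0 * A (i + m) * X i * y i) = 0"
      using False m by (intro sum.neutral) (auto simp: between_weight_def)
    then show ?thesis
      using False m by (simp add: I between_weight_def)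
  qed
  then show ?thesis by (simp add: y_def)
qed

text \<open>The contribution of \<open>p = N\<close>, by the mirror image of the same argument.\<close>
lemma upper_end_sum:
  assumes m: "m \<in> {0..N}"
  shows "2 * (\<Sum>i\<in>{0..N}. between_weight i m N * A (i + m - N) * X i *
            (\<Sum>j\<in>{0..N}. of_int (j - i) * X j * Q (j + N)))
       = - A m * X N * (\<Sum>j\<in>{0..N}. of_int (j - N) * X j * Q (j + N))"
proof -
  define y where "y i = (\<Sum>j\<in>{0..N}. of_int (j - i) * X j * Q (j + N))" for i
  have orth: "(\<Sum>i\<in>{0..N}. X i * A i * y i) = 0"
    using A_orthogonal_euler_sums[of N] by (simp add: y_def)
  have I: "{0..N} = insert N {0..N-1}" using N by auto
  have "2 * (\<Sum>i\<in>{0..N}. between_weight i m N * A (i + m - N) * X i * y i) = - A m * X N * y N"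
  proof (cases "m = N")
    case True
    have "(\<Sum>i\<in>{0..N-1}. between_weight i m N * A (i + m - N) * X i * y i)
        = (\<Sum>i\<in>{0..N-1}. X i * A i * y i / 2)"
      by (intro sum.cong refl) (simp add: True between_weight_def)
    also have "\<dots> = (\<Sum>i\<in>{0..N-1}. X i * A i * y i) / 2"
      by (simp add: sum_divide_distrib)
    finally show ?thesis
      using orth by (simp add: I True between_weight_def add_eq_0_iff mult_ac)
  next
    case False
    have "(\<Sum>i\<in>{0..N-1}. between_weight i m N * A (i + m - N) * X i * y i) = 0"
      using False m by (intro sum.neutral) (auto simp: between_weight_def)
    then show ?thesis
      using False m by (simp add: I between_weight_def)
  qed
  then show ?thesis by (simp add: y_def)
qed

text \<open>
  In the pairing \<open>d = v l\<close> is interior, so \<open>l\<close> avoids \<open>0\<close> and \<open>N\<close>, and this asymmetry would spoil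
  the reflection of \<open>l\<close>. The missing terms can be supplied for free: at an end \<open>a\<close> the weight is
  nonzero only if \<open>i\<close> or \<open>j\<close> is \<open>a\<close>, and the terms add up to an Euler relation of \<open>\<Phi>\<^sub>(\<^sub>0\<^sub>,\<^sub>0\<^sub>)\<close>,
  whatever the factor \<open>Q (a + m)\<close> is.
\<close>
lemma A_Q_part_add_ends:
  "(\<Sum>i\<in>{0..N}. \<Sum>j\<in>{0..N}. \<Sum>l\<in>{1..N-1}.
      of_int (j - i) * between_weight i j l * X i * X j * A (i + j - l) * Q (l + m))
   = (\<Sum>i\<in>{0..N}. \<Sum>j\<in>{0..N}. \<Sum>l\<in>{0..N}.
      of_int (j - i) * between_weight i j l * X i * X j * A (i + j - l) * Q (l + m))"
proof -
  have end_vanishes: "(\<Sum>i\<in>{0..N}. \<Sum>j\<in>{0..N}.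
      of_int (j - i) * between_weight i j a * X i * X j * A (i + j - a)) = 0" (is "?S = 0")
    if a: "a \<in> {0, N}" for a
  proof -
    \<comment> \<open>The row \<open>i = a\<close> and the column \<open>j = a\<close> carry all nonzero terms; they meet where \<open>j - i = 0\<close>.\<close>
    let ?h = "\<lambda>i j. if i = a then of_int \<bar>j - a\<bar> / 2 * X a * X j * A j else 0"
    have "?S = (\<Sum>i\<in>{0..N}. \<Sum>j\<in>{0..N}. ?h i j + ?h j i)"
      using a by (intro sum.cong refl) (auto simp: between_weight_def field_simps)
    also have "\<dots> = 2 * (\<Sum>i\<in>{0..N}. \<Sum>j\<in>{0..N}. ?h i j)"
      by (rule sum_sum_symmetrize)
    also have "(\<Sum>i\<in>{0..N}. \<Sum>j\<in>{0..N}. ?h i j)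
        = (\<Sum>j\<in>{0..N}. of_int \<bar>j - a\<bar> / 2 * X a * X j * A j)"
      using a N by (subst sum.swap) auto
    also have "\<dots> = X a * (if a = 0 then 1 else -1) / 2 * (\<Sum>j\<in>{0..N}. of_int (j - a) * X j * A j)"
      unfolding sum_distrib_left using a by (intro sum.cong refl) (auto simp: field_simps)
    also have "\<dots> = 0"
      by (simp only: A_euler mult_zero_right)
    finally show ?thesis by simp
  qed
  have "(\<Sum>i\<in>{0..N}. \<Sum>j\<in>{0..N}. of_int (j - i) * between_weight i j a * X i * X j
           * A (i + j - a) * Q (a + m)) = 0" if "a \<in> {0, N}" for a
    using end_vanishes[OF that] by (simp flip: sum_distrib_right)
  from this[of 0] this[of N] show ?thesis
    by (simp only: sum_split_ends[of "\<lambda>l. of_int (_ - _) * between_weight _ _ l * X _ * X _ * A (_ - l) * Q (l + m)"]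
          sum.distrib) simp
qed

text \<open>
  Reflecting \<open>l\<close> moves the summation variables \<open>i, j\<close> from \<open>A\<close> to \<open>Q\<close>; splitting the weight at \<open>m\<close>
  then produces an Euler sum of \<open>Q\<close> at \<open>p = i + m - k\<close>, and a second reflection makes \<open>p\<close> the
  summation index. The interior values of \<open>p\<close> give the sum over \<open>P\<close>, the two ends the square sum.
\<close>
lemma A_Q_part:
  assumes m: "m \<in> {0..N}"
  shows "of_int N * (\<Sum>i\<in>{0..N}. \<Sum>j\<in>{0..N}. \<Sum>l\<in>{1..N-1}.
            of_int (j - i) * between_weight i j l * X i * X j * A (i + j - l) * Q (l + m))
       = A m * (\<Sum>i\<in>{0..N}. \<Sum>j\<in>{0..N}. of_int ((j - i)\<^sup>2) * X i * X j * Q (i + j))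
       - 2 * of_int N * (\<Sum>l\<in>{1..N-1}. P l *
            (\<Sum>i\<in>{0..N}. of_int (l - i) * between_weight i m l * X i * A (i + m - l)))"
proof -
  define Y where "Y i p = (\<Sum>j\<in>{0..N}. of_int (j - i) * X j * Q (j + p))" for i p
  let ?T = "\<lambda>p. \<Sum>i\<in>{0..N}. between_weight i m p * A (i + m - p) * X i * Y i p"
  have "(\<Sum>i\<in>{0..N}. \<Sum>j\<in>{0..N}. \<Sum>l\<in>{0..N}.
      of_int (j - i) * between_weight i j l * X i * X j * A (i + j - l) * Q (l + m))
    = (\<Sum>i\<in>{0..N}. \<Sum>j\<in>{0..N}. \<Sum>l\<in>{0..N}.
      of_int (j - i) * between_weight i j l * X i * X j * A l * Q (i + j - l + m))"
  proof (rule sum.cong[OF refl], rule sum.cong[OF refl])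
    fix i j assume "i \<in> {0..N}" "j \<in> {0..N}"
    from sum_between_weight_reflect[OF this,
        of "\<lambda>l k. of_int (j - i) * X i * X j * A k * Q (l + m)"]
    show "(\<Sum>l\<in>{0..N}. of_int (j - i) * between_weight i j l * X i * X j * A (i + j - l) * Q (l + m))
        = (\<Sum>l\<in>{0..N}. of_int (j - i) * between_weight i j l * X i * X j * A l * Q (i + j - l + m))"
      by (simp add: mult_ac)
  qed
  also have "\<dots> = (\<Sum>i\<in>{0..N}. \<Sum>k\<in>{0..N}. \<Sum>j\<in>{0..N}.
      of_int (j - i) * between_weight i j k * X i * X j * A k * Q (i + j - k + m))"
    by (intro sum.cong[OF refl] sum.swap)
  also have "\<dots> = (\<Sum>k\<in>{0..N}. \<Sum>i\<in>{0..N}. \<Sum>j\<in>{0..N}.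
      of_int (j - i) * between_weight i j k * X i * X j * A k * Q (i + j - k + m))"
    by (rule sum.swap)
  also have "\<dots> = (\<Sum>k\<in>{0..N}. 2 * (\<Sum>i\<in>{0..N}. \<Sum>j\<in>{0..N}.
      of_int (j - i) * between_weight i m k * X i * X j * A k * Q (i + j - k + m)))"
    unfolding sum_sum_symmetrize[symmetric]
    by (intro sum.cong refl, subst between_weight_diff[of _ _ _ m]) (simp add: algebra_simps)
  also have "\<dots> = 2 * (\<Sum>k\<in>{0..N}. \<Sum>i\<in>{0..N}. between_weight i m k * A k * X i * Y i (i + m - k))"
    by (simp add: Y_def sum_distrib_left mult_ac algebra_simps)
  also have "\<dots> = 2 * (\<Sum>i\<in>{0..N}. \<Sum>k\<in>{0..N}. between_weight i m k * (A k * X i * Y i (i + m - k)))"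
    by (subst sum.swap) (simp add: mult.assoc)
  also have "\<dots> = 2 * (\<Sum>i\<in>{0..N}. \<Sum>p\<in>{0..N}. between_weight i m p * (A (i + m - p) * X i * Y i p))"
  proof (rule arg_cong[where f = "(*) 2"], rule sum.cong[OF refl])
    fix i assume "i \<in> {0..N}"
    from sum_between_weight_reflect[OF this m, of "\<lambda>k p. A k * X i * Y i p"]
    show "(\<Sum>k\<in>{0..N}. between_weight i m k * (A k * X i * Y i (i + m - k)))
        = (\<Sum>p\<in>{0..N}. between_weight i m p * (A (i + m - p) * X i * Y i p))" .
  qed
  also have "\<dots> = 2 * (\<Sum>p\<in>{0..N}. ?T p)"
    by (subst sum.swap) (simp add: mult.assoc)
  also have "\<dots> = 2 * ?T 0 + 2 * ?T N + 2 * (\<Sum>p\<in>{1..N-1}. ?T p)"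
    by (simp add: sum_split_ends distrib_left)
  also have "2 * ?T 0 = A m * X 0 * Y 0 0"
    using lower_end_sum[OF m] by (simp add: Y_def)
  also have "2 * ?T N = - A m * X N * Y N N"
    using upper_end_sum[OF m] by (simp add: Y_def)
  also have "(\<Sum>p\<in>{1..N-1}. ?T p) = - (\<Sum>p\<in>{1..N-1}. P p *
      (\<Sum>i\<in>{0..N}. of_int (p - i) * between_weight i m p * X i * A (i + m - p)))"
    unfolding sum_distrib_left sum_negf[symmetric]
  proof (intro sum.cong refl)
    fix p i assume p: "p \<in> {1..N-1}"
    show "between_weight i m p * A (i + m - p) * X i * Y i p
      = - (P p * (of_int (p - i) * between_weight i m p * X i * A (i + m - p)))"
      unfolding Y_def Q_euler[OF p] by (simp add: algebra_simps)
  qed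
  finally have *: "(\<Sum>i\<in>{0..N}. \<Sum>j\<in>{0..N}. \<Sum>l\<in>{0..N}.
      of_int (j - i) * between_weight i j l * X i * X j * A (i + j - l) * Q (l + m))
    = A m * (X 0 * Y 0 0 - X N * Y N N) - 2 * (\<Sum>p\<in>{1..N-1}. P p *
      (\<Sum>i\<in>{0..N}. of_int (p - i) * between_weight i m p * X i * A (i + m - p)))"
    by (simp add: algebra_simps)
  \<comment> \<open>Each of the two boundary terms is one half of the double sum.\<close>
  have "of_int N * (X 0 * Y 0 0 - X N * Y N N)
      = (\<Sum>i\<in>{0..N}. \<Sum>j\<in>{0..N}. of_int ((j - i)\<^sup>2) * X i * X j * Q (i + j))"
    using square_Q_sum[of N] square_Q_sum[of 0] by (simp add: Y_def right_diff_distrib)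
  moreover have "n * (a * d - 2 * z) = a * s - 2 * n * z" if "n * d = s" for n a d s z :: 'a
    using that by (auto simp: algebra_simps)
  ultimately show ?thesis
    unfolding A_Q_part_add_ends * by blast
qed

text \<open>
  The left-hand side is what the product rule gives for the derivative of the pairing in \<open>x\<^sub>m\<close>, once
  the sums over \<open>i < j\<close> are written as half of sums over a square; \<open>F\<close> is the value of
  \<open>\<Phi>\<^sub>(\<^sub>0\<^sub>,\<^sub>0\<^sub>)\<close>.
\<close>
lemma pairing_coefficient_eq_0:
  assumes m: "m \<in> {0..N}"
  shows "A m * ((\<Sum>i\<in>{0..N}. \<Sum>j\<in>{0..N}. of_int ((j - i)\<^sup>2) * (X i * X j * Q (i + j))) / 2)
       + F * ((\<Sum>i\<in>{0..N}. \<Sum>j\<in>{0..N}. of_int ((j - i)\<^sup>2) *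
            ((of_bool (m = i) * X j + X i * of_bool (m = j)) * Q (i + j)
              + X i * X j * R (i + j + m))) / 2)
       - of_int N / 2 * (\<Sum>i\<in>{0..N}. \<Sum>j\<in>{0..N}. \<Sum>l\<in>{1..N-1}.
            of_int (j - i) * between_weight i j l *
            ((of_bool (m = i) * X j + X i * of_bool (m = j)) * (A (i + j - l) * P l)
              + X i * X j * (B (i + j - l + m) * P l + A (i + j - l) * Q (l + m)))) = 0"
    (is "A m * (?SQ / 2) + F * (?DF / 2) - of_int N / 2 * ?W = 0")
proof -
  let ?d = "\<lambda>i j. of_bool (m = i) * X j + X i * of_bool (m = j)"
  let ?K = "\<lambda>i j l. of_int (j - i) * between_weight i j l"
  let ?AQ = "\<Sum>i\<in>{0..N}. \<Sum>j\<in>{0..N}. \<Sum>l\<in>{1..N-1}. ?K i j l * X i * X j * A (i + j - l) * Q (l + m)"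
  let ?c = "\<lambda>l. \<Sum>i\<in>{0..N}. of_int (l - i) * between_weight i m l * X i * A (i + m - l)"
  have "?DF = (\<Sum>i\<in>{0..N}. \<Sum>j\<in>{0..N}. of_int ((j - i)\<^sup>2) * Q (i + j) * ?d i j)
      + (\<Sum>i\<in>{0..N}. \<Sum>j\<in>{0..N}. of_int ((j - i)\<^sup>2) * X i * X j * R (i + j + m))"
    by (simp only: distrib_left sum.distrib mult_ac)
  also have "(\<Sum>i\<in>{0..N}. \<Sum>j\<in>{0..N}. of_int ((j - i)\<^sup>2) * Q (i + j) * ?d i j)
      = 2 * (\<Sum>j\<in>{0..N}. of_int ((j - m)\<^sup>2) * Q (m + j) * X j)"
    using m by (intro sum_sum_coordinate_derivatives) (simp_all add: power2_commute add.commute)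
  finally have DF: "?DF = 0"
    using Phi0_part_vanishes[OF m] by (simp only: mult_ac add_ac)
  have "?W = (\<Sum>i\<in>{0..N}. \<Sum>j\<in>{0..N}. \<Sum>l\<in>{1..N-1}. P l * (?K i j l * A (i + j - l) * ?d i j
      + ?K i j l * X i * X j * B (i + j - l + m))) + ?AQ"
    by (simp only: distrib_left distrib_right sum.distrib mult_ac add_ac)
  also have "(\<Sum>i\<in>{0..N}. \<Sum>j\<in>{0..N}. \<Sum>l\<in>{1..N-1}. P l * (?K i j l * A (i + j - l) * ?d i j
      + ?K i j l * X i * X j * B (i + j - l + m)))
    = (\<Sum>i\<in>{0..N}. \<Sum>l\<in>{1..N-1}. \<Sum>j\<in>{0..N}. P l * (?K i j l * A (i + j - l) * ?d i j
      + ?K i j l * X i * X j * B (i + j - l + m)))"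
    by (intro sum.cong[OF refl] sum.swap)
  also have "\<dots> = (\<Sum>l\<in>{1..N-1}. \<Sum>i\<in>{0..N}. \<Sum>j\<in>{0..N}. P l * (?K i j l * A (i + j - l) * ?d i j
      + ?K i j l * X i * X j * B (i + j - l + m)))"
    by (rule sum.swap)
  also have "\<dots> = (\<Sum>l\<in>{1..N-1}. P l * (2 * ?c l))"
  proof (rule sum.cong[OF refl])
    fix l assume "l \<in> {1..N-1}"
    then have l: "l \<in> {0..N}" by simp
    have "(\<Sum>i\<in>{0..N}. \<Sum>j\<in>{0..N}. ?K i j l * A (i + j - l) * ?d i j)
        = 2 * (\<Sum>j\<in>{0..N}. ?K m j l * A (m + j - l) * X j)"
    proof (rule sum_sum_coordinate_derivatives)
      show "?K i j l * A (i + j - l) = ?K j i l * A (j + i - l)" for i j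
        by (subst between_weight_commute) (simp add: algebra_simps)
    qed (use m in simp_all)
    then have "(\<Sum>i\<in>{0..N}. \<Sum>j\<in>{0..N}. ?K i j l * A (i + j - l) * ?d i j
        + ?K i j l * X i * X j * B (i + j - l + m)) = 2 * ?c l"
      using Psi1_part[OF m l] by (simp only: sum.distrib mult_ac add_ac)
    then show "(\<Sum>i\<in>{0..N}. \<Sum>j\<in>{0..N}. P l * (?K i j l * A (i + j - l) * ?d i j
        + ?K i j l * X i * X j * B (i + j - l + m))) = P l * (2 * ?c l)"
      by (simp only: flip: sum_distrib_left)
  qed
  also have "\<dots> = 2 * (\<Sum>l\<in>{1..N-1}. P l * ?c l)"
    by (simp only: sum_distrib_left mult.left_commute)
  finally have W: "?W = 2 * (\<Sum>l\<in>{1..N-1}. P l * ?c l) + ?AQ" .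
  have "of_int N * ?AQ = A m * ?SQ - 2 * of_int N * (\<Sum>l\<in>{1..N-1}. P l * ?c l)"
    using A_Q_part[OF m] by (simp only: mult.assoc)
  moreover have "a * (s / 2) + F * (0 / 2) - n / 2 * (2 * z + w) = 0"
    if "n * w = a * s - 2 * n * z" for a s n w z :: 'a
    using that by (simp add: field_simps)
  ultimately show ?thesis
    unfolding DF W by blast
qed

end

section \<open>The pairing as a sum over squares\<close>

lemma sigma_eq:
  assumes "i < j"
  shows "sigma i j = {p. real i * snd p \<le> fst p \<and> fst p \<le> real j * snd p}"
    (is "_ = ?K")
proof
  have "convex_cone ?K"
    unfolding convex_cone_iff
    by (auto simp: distrib_left add_mono mult.left_commute mult_left_mono)
  then show "sigma i j \<subseteq> ?K"
    unfolding sigma_def using assms by (intro hull_minimal) (auto simp: lat_real_def v_def)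
next
  show "?K \<subseteq> sigma i j"
  proof
    fix p assume p: "p \<in> ?K"
    let ?s = "(real j * snd p - fst p) / (real j - real i)"
    let ?t = "(fst p - real i * snd p) / (real j - real i)"
    have "convex_cone (sigma i j)"
      by (simp add: sigma_def convex_cone_convex_cone_hull)
    moreover have "lat_real (v i) \<in> sigma i j" "lat_real (v j) \<in> sigma i j"
      by (simp_all add: sigma_def hull_inc)
    moreover have "0 \<le> ?s" "0 \<le> ?t"
      using assms p by simp_all
    ultimately have "?s *\<^sub>R lat_real (v i) + ?t *\<^sub>R lat_real (v j) \<in> sigma i j"
      by (meson convex_cone_iff)
    moreover have "?s *\<^sub>R lat_real (v i) + ?t *\<^sub>R lat_real (v j) = p"
    proof -
      obtain m where "j = i + m" "0 < m"
        using assms less_imp_add_positive by blast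
      then show ?thesis
        by (simp add: lat_real_def v_def prod_eq_iff field_simps)
    qed
    ultimately show "p \<in> sigma i j"
      by simp
  qed
qed

lemma interior_sigma_eq:
  assumes "i < j"
  shows "interior (sigma i j) = {p. real i * snd p < fst p \<and> fst p < real j * snd p}"
proof -
  have "sigma i j = {p. (- 1, real i) \<bullet> p \<le> 0} \<inter> {p. (1, - real j) \<bullet> p \<le> 0}"
    using assms by (auto simp: sigma_eq)
  also have "interior \<dots> = {p. (- 1, real i) \<bullet> p < 0} \<inter> {p. (1, - real j) \<bullet> p < 0}"
    by (simp add: interior_halfspace_le zero_prod_def)
  also have "\<dots> = {p. real i * snd p < fst p \<and> fst p < real j * snd p}"
    by (rule set_eqI) (simp add: inner_prod_def)
  finally show ?thesis .
qed

lemma lat_points_sigma: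
  assumes "i < j"
  shows "(k, d) \<in> lat_points (sigma i j) \<longleftrightarrow> int i * d \<le> k \<and> k \<le> int j * d"
    and "lat_real (k, d) \<in> interior (sigma i j) \<longleftrightarrow> int i * d < k \<and> k < int j * d"
proof -
  have "real m * of_int d = of_int (int m * d)" for m
    by simp
  then show "(k, d) \<in> lat_points (sigma i j) \<longleftrightarrow> int i * d \<le> k \<and> k \<le> int j * d"
    and "lat_real (k, d) \<in> interior (sigma i j) \<longleftrightarrow> int i * d < k \<and> k < int j * d"
    unfolding lat_points_def lat_real_def interior_sigma_eq[OF assms] unfolding sigma_eq[OF assms]
    by (simp_all only: mem_Collect_eq fst_conv snd_conv of_int_le_iff of_int_less_iff)
qed

lemma cone_C_eq_sigma: "cone_C n = sigma 0 n"
  by (simp add: cone_C_def sigma_def)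

lemma lat_points_cone_C:
  assumes "1 \<le> n"
  shows "(k, d) \<in> lat_points (cone_C n) \<longleftrightarrow> 0 \<le> k \<and> k \<le> int n * d"
    and "(k, d) \<in> lat_points (interior (cone_C n)) \<longleftrightarrow> 0 < k \<and> k < int n * d"
  using lat_points_sigma[of 0 n k d] assms by (simp_all add: cone_C_eq_sigma lat_points_def)

text \<open>
  An index pair is determined by \<open>d = v l\<close>. The condition \<open>d \<in> C\<degree>\<close> is \<open>0 < l < n\<close>, while
  membership in \<open>sigma i j\<close> and the factor \<open>delta\<close> are together the betweenness weight.
\<close>
lemma inner_sum_eq:
  assumes "1 \<le> n" "i < j" "j \<le> n"
  shows "(\<Sum>(c, d)\<in>inner_index n i j. delta i j c * \<Phi> c x * \<Psi> d x)
       = (\<Sum>l\<in>{1..int n - 1}. between_weight (int i) (int j) l *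
            (\<Phi> (int i + int j - l, 1) x * \<Psi> (l, 1) x))"
proof -
  let ?w = "between_weight (int i) (int j) :: int \<Rightarrow> complex"
  let ?L = "{max 1 (int i)..min (int n - 1) (int j)}"
  have "(\<Sum>(c, d)\<in>inner_index n i j. delta i j c * \<Phi> c x * \<Psi> d x)
      = (\<Sum>l\<in>?L. ?w l * (\<Phi> (int i + int j - l, 1) x * \<Psi> (l, 1) x))"
  proof (rule sum.reindex_bij_witness[where j = "\<lambda>(c, d). fst d"
        and i = "\<lambda>l. ((int i + int j - l, 1), (l, 1))"])
    fix p assume p: "p \<in> inner_index n i j"
    obtain k a l b where "p = ((k, a), (l, b))" by (metis surj_pair)
    with p assms have *: "p = ((int i + int j - l, 1), (l, 1))" "l \<in> ?L"
      by (auto simp: inner_index_def lat_points_sigma lat_points_cone_C lat_deg_def v_def)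
    then show "((int i + int j - (case p of (c, d) \<Rightarrow> fst d), 1), (case p of (c, d) \<Rightarrow> fst d), 1) = p"
      and "(case p of (c, d) \<Rightarrow> fst d) \<in> ?L"
      by simp_all
    have "delta i j (int i + int j - l, 1) = ?w l"
      using *(2) assms
      by (auto simp: delta_def lat_points_sigma between_weight_def sgn_if)
    then show "?w (case p of (c, d) \<Rightarrow> fst d) * (\<Phi> (int i + int j - (case p of (c, d) \<Rightarrow> fst d), 1) x *
        \<Psi> ((case p of (c, d) \<Rightarrow> fst d), 1) x) = (case p of (c, d) \<Rightarrow> delta i j c * \<Phi> c x * \<Psi> d x)"
      using *(1) by simp
  next
    fix l assume l: "l \<in> ?L"
    then show "((int i + int j - l, 1), (l, 1)) \<in> inner_index n i j"
      using assms
      by (auto simp: inner_index_def lat_points_sigma lat_points_cone_C lat_deg_def v_def)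
  qed simp
  also have "\<dots> = (\<Sum>l\<in>{1..int n - 1}. ?w l * (\<Phi> (int i + int j - l, 1) x * \<Psi> (l, 1) x))"
  proof (rule sum.mono_neutral_left)
    have "?w l = 0" if "l \<in> {1..int n - 1} - ?L" for l
      using that between_weight_nonzeroD[of "int i" "int j" l, where ?'a = complex] assms
      by (smt (verit) DiffE atLeastAtMost_iff of_nat_less_iff)
    then show "\<forall>l\<in>{1..int n - 1} - ?L. ?w l * (\<Phi> (int i + int j - l, 1) x * \<Psi> (l, 1) x) = 0"
      by simp
  qed auto
  finally show ?thesis .
qed

lemma sum_strict_pairs_eq_half_square:
  fixes g :: "int \<Rightarrow> int \<Rightarrow> 'a::field_char_0"
  assumes sym: "\<And>i j. g i j = g j i" and diag: "\<And>i. g i i = 0"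
  shows "(\<Sum>(i, j)\<in>{(i, j). i < j \<and> j \<le> n}. g (int i) (int j))
       = (\<Sum>i\<in>{0..int n}. \<Sum>j\<in>{0..int n}. g i j) / 2"
proof -
  let ?h = "\<lambda>i j. if i < j then g i j else 0"
  have I: "{0..int n} = int ` {..n}"
    by (auto simp: image_iff intro!: bexI[of _ "nat _"])
  have "(\<Sum>i\<in>{0..int n}. \<Sum>j\<in>{0..int n}. g i j)
      = (\<Sum>i\<in>{0..int n}. \<Sum>j\<in>{0..int n}. ?h i j + ?h j i)"
    by (intro sum.cong refl) (auto simp: sym diag not_less le_less)
  also have "\<dots> = 2 * (\<Sum>i\<in>{0..int n}. \<Sum>j\<in>{0..int n}. ?h i j)"
    by (rule sum_sum_symmetrize)
  also have "(\<Sum>i\<in>{0..int n}. \<Sum>j\<in>{0..int n}. ?h i j)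
      = (\<Sum>(i, j)\<in>{..n} \<times> {..n}. if i < j then g (int i) (int j) else 0)"
    by (simp add: I sum.reindex flip: sum.cartesian_product)
  also have "\<dots> = (\<Sum>(i, j)\<in>{(i, j). i < j \<and> j \<le> n}. g (int i) (int j))"
    by (rule sum.mono_neutral_cong_right) (auto split: if_splits)
  finally show ?thesis by simp
qed

lemma pairing_eq_symmetric_sums:
  assumes "1 \<le> n"
  shows "pairing e n \<Phi> \<Psi> x =
    \<Phi> (0, 0) x * ((\<Sum>i\<in>{0..int n}. \<Sum>j\<in>{0..int n}. of_int ((j - i)\<^sup>2) *
        (x $ e (nat i) * x $ e (nat j) * \<Psi> (i + j, 2) x)) / 2)
    - of_int (int n) / 2 * (\<Sum>i\<in>{0..int n}. \<Sum>j\<in>{0..int n}. \<Sum>l\<in>{1..int n - 1}.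
        of_int (j - i) * between_weight i j l *
        (x $ e (nat i) * x $ e (nat j) * (\<Phi> (i + j - l, 1) x * \<Psi> (l, 1) x)))"
proof -
  let ?g = "\<lambda>i j. of_int ((j - i)\<^sup>2) * (x $ e (nat i) * x $ e (nat j) * \<Psi> (i + j, 2) x)"
  let ?k = "\<lambda>i j. \<Sum>l\<in>{1..int n - 1}. of_int (j - i) * between_weight i j l *
        (x $ e (nat i) * x $ e (nat j) * (\<Phi> (i + j - l, 1) x * \<Psi> (l, 1) x))"
  have "(\<Sum>(i, j)\<in>{(i, j). i < j \<and> j \<le> n}.
         (of_nat j - of_nat i)\<^sup>2 * x $ e i * x $ e j * \<Psi> (v i + v j) x)
      = (\<Sum>(i, j)\<in>{(i, j). i < j \<and> j \<le> n}. ?g (int i) (int j))"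
    by (intro sum.cong refl) (auto simp: v_def mult_ac)
  also have "\<dots> = (\<Sum>i\<in>{0..int n}. \<Sum>j\<in>{0..int n}. ?g i j) / 2"
    by (rule sum_strict_pairs_eq_half_square) (simp_all add: power2_commute add_ac mult_ac)
  finally have g: "(\<Sum>(i, j)\<in>{(i, j). i < j \<and> j \<le> n}.
         (of_nat j - of_nat i)\<^sup>2 * x $ e i * x $ e j * \<Psi> (v i + v j) x)
      = (\<Sum>i\<in>{0..int n}. \<Sum>j\<in>{0..int n}. ?g i j) / 2" .
  have "(\<Sum>(i, j)\<in>{(i, j). i < j \<and> j \<le> n}. of_nat n * (of_nat j - of_nat i) * x $ e i * x $ e j *
           (\<Sum>(c, d)\<in>inner_index n i j. delta i j c * \<Phi> c x * \<Psi> d x))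
      = (\<Sum>(i, j)\<in>{(i, j). i < j \<and> j \<le> n}. of_nat n * ?k (int i) (int j))"
  proof (rule sum.cong[OF refl], clarify)
    fix i j assume "i < j" "j \<le> n"
    from inner_sum_eq[OF assms this, of \<Phi> x \<Psi>]
    show "of_nat n * (of_nat j - of_nat i) * x $ e i * x $ e j *
           (\<Sum>(c, d)\<in>inner_index n i j. delta i j c * \<Phi> c x * \<Psi> d x) = of_nat n * ?k (int i) (int j)"
      by (simp only:) (simp add: sum_distrib_left mult_ac)
  qed
  also have "\<dots> = of_nat n * (\<Sum>(i, j)\<in>{(i, j). i < j \<and> j \<le> n}. ?k (int i) (int j))"
    by (simp add: sum_distrib_left case_prod_unfold)
  also have "(\<Sum>(i, j)\<in>{(i, j). i < j \<and> j \<le> n}. ?k (int i) (int j))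
      = (\<Sum>i\<in>{0..int n}. \<Sum>j\<in>{0..int n}. ?k i j) / 2"
  proof (rule sum_strict_pairs_eq_half_square)
    show "?k i j = ?k j i" for i j
      by (subst between_weight_commute, intro sum.cong refl) (simp add: algebra_simps)
  qed simp
  finally show ?thesis
    unfolding pairing_def g by simp
qed

section \<open>Gradients in the labelled coordinates\<close>

text \<open>
  Complex differentiability with the gradient indexed by \<open>{0..n}\<close> through the labelling \<open>e\<close>; integer
  indices let it be combined directly with lattice points.
\<close>
definition has_coord_gradient ::
    "(nat \<Rightarrow> 'm::finite) \<Rightarrow> nat \<Rightarrow> (complex ^ 'm \<Rightarrow> complex) \<Rightarrow> (int \<Rightarrow> complex) \<Rightarrow> complex ^ 'm \<Rightarrow> bool"
  where "has_coord_gradient e n f g x \<longleftrightarrow>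
    (f has_derivative (\<lambda>w. \<Sum>m\<in>{0..int n}. w $ e (nat m) * g m)) (at x)"

lemma has_coord_gradient_const: "has_coord_gradient e n (\<lambda>x. c) (\<lambda>m. 0) x"
  by (simp add: has_coord_gradient_def)

lemma has_coord_gradient_add:
  assumes "has_coord_gradient e n f f' x" "has_coord_gradient e n g g' x"
  shows "has_coord_gradient e n (\<lambda>x. f x + g x) (\<lambda>m. f' m + g' m) x"
  using has_derivative_add[OF assms[unfolded has_coord_gradient_def]]
  by (simp add: has_coord_gradient_def distrib_left sum.distrib)

lemma has_coord_gradient_diff:
  assumes "has_coord_gradient e n f f' x" "has_coord_gradient e n g g' x"
  shows "has_coord_gradient e n (\<lambda>x. f x - g x) (\<lambda>m. f' m - g' m) x"
  using has_derivative_diff[OF assms[unfolded has_coord_gradient_def]]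
  by (simp add: has_coord_gradient_def right_diff_distrib sum_subtractf)

lemma has_coord_gradient_mult:
  assumes "has_coord_gradient e n f f' x" "has_coord_gradient e n g g' x"
  shows "has_coord_gradient e n (\<lambda>x. f x * g x) (\<lambda>m. f' m * g x + f x * g' m) x"
  using has_derivative_mult[OF assms[unfolded has_coord_gradient_def]]
  by (simp add: has_coord_gradient_def distrib_left sum.distrib sum_distrib_left mult_ac add_ac)

text \<open>
  The guard \<open>c \<noteq> 0\<close> matters: terms of the pairing with coefficient zero can contain members
  of a solution at lattice points outside its index set, about which nothing is known.
\<close>
lemma has_coord_gradient_cmult:
  assumes "c \<noteq> 0 \<Longrightarrow> has_coord_gradient e n f f' x"
  shows "has_coord_gradient e n (\<lambda>x. c * f x) (\<lambda>m. c * f' m) x"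
proof (cases "c = 0")
  case False
  from has_coord_gradient_mult[OF has_coord_gradient_const assms[OF this], of c]
  show ?thesis by simp
qed (simp add: has_coord_gradient_const)

lemma has_coord_gradient_divide:
  assumes "has_coord_gradient e n f f' x"
  shows "has_coord_gradient e n (\<lambda>x. f x / c) (\<lambda>m. f' m / c) x"
  using has_coord_gradient_cmult[OF assms, of "inverse c"]
  by (simp only: divide_inverse mult.commute)

lemma has_coord_gradient_sum:
  assumes "\<And>k. k \<in> K \<Longrightarrow> has_coord_gradient e n (f k) (f' k) x"
  shows "has_coord_gradient e n (\<lambda>x. \<Sum>k\<in>K. f k x) (\<lambda>m. \<Sum>k\<in>K. f' k m) x"
  using assms
  by (induction K rule: infinite_finite_induct) (simp_all add: has_coord_gradient_const has_coord_gradient_add)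

lemma has_coord_gradient_coordinate:
  assumes "k \<in> {0..int n}"
  shows "has_coord_gradient e n (\<lambda>x. x $ e (nat k)) (\<lambda>m. of_bool (m = k)) x"
proof -
  have "((\<lambda>x. x $ e (nat k)) has_derivative (\<lambda>w. w $ e (nat k))) (at x)"
    by (intro bounded_linear_imp_has_derivative bounded_linear_vec_nth)
  then show ?thesis
    using assms by (simp add: has_coord_gradient_def of_bool_def if_distrib cong: if_cong)
qed

lemma sum_coordinates_eq:
  assumes "bij_betw e {0..n} (UNIV :: 'm::finite set)"
  shows "(\<Sum>k\<in>UNIV. f k) = (\<Sum>m\<in>{0..int n}. f (e (nat m)))"
proof -
  have "bij_betw nat {0..int n} {0..n}"
    by (rule bij_betw_byWitness[where f' = int]) auto
  then have "bij_betw (e \<circ> nat) {0..int n} UNIV"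
    using assms by (rule bij_betw_trans)
  from sum.reindex_bij_betw[OF this, of f] show ?thesis
    by simp
qed

text \<open>
  Complex linearity of the derivative \<open>D\<close> gives \<open>D w = \<Sum>\<^sub>k w\<^sub>k D (axis k 1)\<close>, and restricting to the
  line through \<open>x\<close> in the direction of the \<open>k\<close>-th axis identifies \<open>D (axis k 1)\<close> with
  the partial derivative.
\<close>
lemma holomorphic_several_coord_gradient:
  fixes e :: "nat \<Rightarrow> 'm::finite"
  assumes e: "bij_betw e {0..n} UNIV" and f: "holomorphic_several U f" and x: "x \<in> U"
  shows "has_coord_gradient e n f (\<lambda>m. partial_deriv e (nat m) f x) x"
proof -
  obtain D where D: "(f has_derivative D) (at x)" and clin: "\<And>a w. D (a *s w) = a * D w"
    using f x unfolding holomorphic_several_def by blast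
  interpret D: bounded_linear D
    by (rule has_derivative_bounded_linear[OF D])
  have axis: "axis k t = t *s axis k 1" for k :: 'm and t :: complex
    by (simp add: vec_eq_iff axis_def)
  have partial: "partial_deriv e i f x = D (axis (e i) 1)" for i
  proof -
    have "linear (\<lambda>t::complex. axis (e i) t)"
      by (rule linearI) (simp_all add: vec_eq_iff axis_def)
    then have line: "((\<lambda>t::complex. x + axis (e i) t) has_derivative (\<lambda>t. axis (e i) t)) (at 0)"
      by (auto intro!: derivative_eq_intros bounded_linear_imp_has_derivative
          simp: linear_conv_bounded_linear)
    have at_0: "x + axis (e i) 0 = x"
      by (simp add: vec_eq_iff axis_def)
    have "((\<lambda>t. f (x + axis (e i) t)) has_derivative (\<lambda>t. D (axis (e i) t))) (at 0)"
      by (rule has_derivative_compose[OF line]) (simp only: at_0 D)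
    moreover have "(\<lambda>t. D (axis (e i) t)) = (*) (D (axis (e i) 1))"
      by (rule ext, subst axis) (simp add: clin mult.commute)
    ultimately show ?thesis
      unfolding partial_deriv_def
      by (intro DERIV_imp_deriv) (simp add: has_field_derivative_def)
  qed
  have "D w = (\<Sum>m\<in>{0..int n}. w $ e (nat m) * partial_deriv e (nat m) f x)" for w
  proof -
    have "D w = D (\<Sum>k\<in>UNIV. w $ k *s axis k 1)"
      by (simp add: basis_expansion)
    also have "\<dots> = (\<Sum>k\<in>UNIV. w $ k * D (axis k 1))"
      by (simp add: D.sum clin)
    finally show ?thesis
      by (simp add: sum_coordinates_eq[OF e] partial)
  qed
  then show ?thesis
    using D unfolding has_coord_gradient_def by presburger
qed

section \<open>Solutions of the systems and constancy of the pairing\<close>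

lemma bbGKZ_solution_coord_gradient:
  fixes e :: "nat \<Rightarrow> 'm::finite"
  assumes e: "bij_betw e {0..n} UNIV" and sol: "bbGKZ_solution e n S U \<Phi>"
    and c: "(k, d) \<in> S" and x: "x \<in> U"
  shows "has_coord_gradient e n (\<Phi> (k, d)) (\<lambda>m. \<Phi> (k + m, d + 1) x) x"
proof -
  have "has_coord_gradient e n (\<Phi> (k, d)) (\<lambda>m. partial_deriv e (nat m) (\<Phi> (k, d)) x) x"
    using sol c x e by (intro holomorphic_several_coord_gradient) (auto simp: bbGKZ_solution_def)
  moreover have "partial_deriv e (nat m) (\<Phi> (k, d)) x = \<Phi> (k + m, d + 1) x"
    if "m \<in> {0..int n}" for m
  proof -
    have "partial_deriv e (nat m) (\<Phi> (k, d)) x = \<Phi> ((k, d) + v (nat m)) x"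
      using sol c x that unfolding bbGKZ_solution_def by (simp add: nat_le_iff)
    then show ?thesis using that by (simp add: v_def)
  qed
  then have "(\<Sum>m\<in>{0..int n}. w $ e (nat m) * partial_deriv e (nat m) (\<Phi> (k, d)) x)
      = (\<Sum>m\<in>{0..int n}. w $ e (nat m) * \<Phi> (k + m, d + 1) x)" for w
    by (intro sum.cong refl) simp
  ultimately show ?thesis
    by (simp only: has_coord_gradient_def)
qed

text \<open>Replacing the partial derivatives by shifted members makes the second family of equations
  algebraic; it is used for the two coordinate functions of the lattice.\<close>
lemma bbGKZ_solution_euler:
  assumes sol: "bbGKZ_solution e n S U \<Phi>" and c: "(k, d) \<in> S" and x: "x \<in> U"
  shows "(\<Sum>j\<in>{0..int n}. x $ e (nat j) * \<Phi> (j + k, d + 1) x) = - of_int d * \<Phi> (k, d) x"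
    and "(\<Sum>j\<in>{0..int n}. of_int j * x $ e (nat j) * \<Phi> (j + k, d + 1) x) = - of_int k * \<Phi> (k, d) x"
proof -
  have I: "{0..int n} = int ` {0..n}"
    by (simp add: image_int_atLeastAtMost)
  have euler: "(\<Sum>i=0..n. of_int (\<mu> (v i)) * x $ e i * \<Phi> ((k, d) + v i) x)
      = - of_int (\<mu> (k, d)) * \<Phi> (k, d) x"
    if "Modules.additive \<mu>" for \<mu> :: "lattice \<Rightarrow> int"
  proof -
    have "(\<Sum>i=0..n. of_int (\<mu> (v i)) * x $ e i * partial_deriv e i (\<Phi> (k, d)) x)
         + of_int (\<mu> (k, d)) * \<Phi> (k, d) x = 0"
      using sol c x that unfolding bbGKZ_solution_def by blast
    moreover have "partial_deriv e i (\<Phi> (k, d)) x = \<Phi> ((k, d) + v i) x" if "i \<in> {0..n}" for i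
      using sol c x that unfolding bbGKZ_solution_def by simp
    ultimately show ?thesis
      by (simp add: add_eq_0_iff2)
  qed
  show "(\<Sum>j\<in>{0..int n}. x $ e (nat j) * \<Phi> (j + k, d + 1) x) = - of_int d * \<Phi> (k, d) x"
    using euler[of snd] by (simp add: I sum.reindex v_def Modules.additive_def add.commute)
  show "(\<Sum>j\<in>{0..int n}. of_int j * x $ e (nat j) * \<Phi> (j + k, d + 1) x) = - of_int k * \<Phi> (k, d) x"
    using euler[of fst] by (simp add: I sum.reindex v_def Modules.additive_def add.commute)
qed

lemma bbGKZ_solutions_values_at_point:
  assumes n: "1 \<le> n" and x: "x \<in> U"
    and \<Phi>: "bbGKZ_solution e n (lat_points (cone_C n)) U \<Phi>"
    and \<Psi>: "bbGKZ_solution e n (lat_points (interior (cone_C n))) U \<Psi>"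
  shows "bbGKZ_values_at_point (int n) (\<lambda>i. x $ e (nat i)) (\<lambda>k. \<Phi> (k, 1) x) (\<lambda>k. \<Phi> (k, 2) x)
           (\<lambda>k. \<Psi> (k, 1) x) (\<lambda>k. \<Psi> (k, 2) x) (\<lambda>k. \<Psi> (k, 3) x)"
  using bbGKZ_solution_euler[OF \<Phi> _ x, of 0 0] bbGKZ_solution_euler[OF \<Phi> _ x, of _ 1]
    bbGKZ_solution_euler[OF \<Psi> _ x, of _ 1] bbGKZ_solution_euler[OF \<Psi> _ x, of _ 2] n
  by unfold_locales (simp_all add: lat_points_cone_C)

lemma has_coord_gradient_zeroD:
  assumes "has_coord_gradient e n f g x" and "\<And>m. m \<in> {0..int n} \<Longrightarrow> g m = 0"
  shows "(f has_derivative (\<lambda>w. 0)) (at x)"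
proof -
  have "(\<Sum>m\<in>{0..int n}. w $ e (nat m) * g m) = 0" for w
    by (intro sum.neutral) (simp add: assms(2))
  then show ?thesis
    using assms(1) by (simp only: has_coord_gradient_def)
qed

theorem theorem3p2:
  fixes n :: nat
    and e :: "nat \<Rightarrow> 'm::finite"
    and U :: "(complex ^ 'm) set"
    and \<Phi> \<Psi> :: "lattice \<Rightarrow> complex ^ 'm \<Rightarrow> complex"
  assumes "n \<ge> 1"
    and "bij_betw e {0..n} UNIV"
    and "open U" and "connected U" and "U \<subseteq> nondeg_locus e n"
    and "bbGKZ_solution e n (lat_points (cone_C n)) U \<Phi>"
    and "bbGKZ_solution e n (lat_points (interior (cone_C n))) U \<Psi>"
  shows "pairing e n \<Phi> \<Psi> constant_on U"
proof -
  note n = \<open>n \<ge> 1\<close> and e = assms(2) and \<Phi> = assms(6) and \<Psi> = assms(7)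
  have "(pairing e n \<Phi> \<Psi> has_derivative (\<lambda>w. 0)) (at x)" if x: "x \<in> U" for x
  proof -
    interpret bbGKZ_values_at_point "int n" "\<lambda>i. x $ e (nat i)" "\<lambda>k. \<Phi> (k, 1) x" "\<lambda>k. \<Phi> (k, 2) x"
        "\<lambda>k. \<Psi> (k, 1) x" "\<lambda>k. \<Psi> (k, 2) x" "\<lambda>k. \<Psi> (k, 3) x"
      by (rule bbGKZ_solutions_values_at_point[OF n x \<Phi> \<Psi>])
    have F: "has_coord_gradient e n (\<Phi> (0, 0)) (\<lambda>m. \<Phi> (m, 1) x) x"
      using bbGKZ_solution_coord_gradient[OF e \<Phi> _ x, of 0 0] n by (simp add: lat_points_cone_C)
    have A: "has_coord_gradient e n (\<Phi> (k, 1)) (\<lambda>m. \<Phi> (k + m, 2) x) x" if "k \<in> {0..int n}" for k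
      using bbGKZ_solution_coord_gradient[OF e \<Phi> _ x, of k 1] n that by (simp add: lat_points_cone_C)
    have P: "has_coord_gradient e n (\<Psi> (k, 1)) (\<lambda>m. \<Psi> (k + m, 2) x) x" if "k \<in> {1..int n - 1}" for k
      using bbGKZ_solution_coord_gradient[OF e \<Psi> _ x, of k 1] n that by (simp add: lat_points_cone_C)
    have Q: "has_coord_gradient e n (\<Psi> (k, 2)) (\<lambda>m. \<Psi> (k + m, 3) x) x" if "k \<in> {1..2 * int n - 1}" for k
      using bbGKZ_solution_coord_gradient[OF e \<Psi> _ x, of k 2] n that by (simp add: lat_points_cone_C)
    let ?X = "\<lambda>i. x $ e (nat i)"
    let ?d = "\<lambda>m i j. of_bool (m = i) * ?X j + ?X i * of_bool (m = j)"
    let ?g = "\<lambda>m. \<Phi> (m, 1) x * ((\<Sum>i\<in>{0..int n}. \<Sum>j\<in>{0..int n}.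
          of_int ((j - i)\<^sup>2) * (?X i * ?X j * \<Psi> (i + j, 2) x)) / 2)
        + \<Phi> (0, 0) x * ((\<Sum>i\<in>{0..int n}. \<Sum>j\<in>{0..int n}.
          of_int ((j - i)\<^sup>2) * (?d m i j * \<Psi> (i + j, 2) x + ?X i * ?X j * \<Psi> (i + j + m, 3) x)) / 2)
        - of_int (int n) / 2 * (\<Sum>i\<in>{0..int n}. \<Sum>j\<in>{0..int n}. \<Sum>l\<in>{1..int n - 1}.
          of_int (j - i) * between_weight i j l *
            (?d m i j * (\<Phi> (i + j - l, 1) x * \<Psi> (l, 1) x)
              + ?X i * ?X j * (\<Phi> (i + j - l + m, 2) x * \<Psi> (l, 1) x
                 + \<Phi> (i + j - l, 1) x * \<Psi> (l + m, 2) x)))"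
    have "has_coord_gradient e n (pairing e n \<Phi> \<Psi>) ?g x"
      unfolding pairing_eq_symmetric_sums[OF n, abs_def]
    proof (intro has_coord_gradient_diff has_coord_gradient_mult[OF F] has_coord_gradient_divide
        has_coord_gradient_sum has_coord_gradient_cmult)
      fix i j assume ij: "i \<in> {0..int n}" "j \<in> {0..int n}"
      have X: "has_coord_gradient e n (\<lambda>y. y $ e (nat i) * y $ e (nat j)) (\<lambda>m. ?d m i j) x"
        by (intro has_coord_gradient_mult has_coord_gradient_coordinate ij)
      {
        assume "of_int ((j - i)\<^sup>2) \<noteq> (0::complex)"
        \<comment> \<open>For \<open>i \<noteq> j\<close> the point \<open>v i + v j\<close> is interior to the cone.\<close>
        then have "i + j \<in> {1..2 * int n - 1}" using ij by auto
        then show "has_coord_gradient e n (\<lambda>y. y $ e (nat i) * y $ e (nat j) * \<Psi> (i + j, 2) y)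
            (\<lambda>m. ?d m i j * \<Psi> (i + j, 2) x + ?X i * ?X j * \<Psi> (i + j + m, 3) x) x"
          by (intro has_coord_gradient_mult X Q)
      next
        fix l assume l: "l \<in> {1..int n - 1}"
          and "of_int (j - i) * between_weight i j l \<noteq> (0::complex)"
        then have "between_weight i j l \<noteq> (0::complex)" by auto
        from between_weight_nonzeroD[OF this] have "i + j - l \<in> {0..int n}" using ij by auto
        then show "has_coord_gradient e n
            (\<lambda>y. y $ e (nat i) * y $ e (nat j) * (\<Phi> (i + j - l, 1) y * \<Psi> (l, 1) y))
            (\<lambda>m. ?d m i j * (\<Phi> (i + j - l, 1) x * \<Psi> (l, 1) x)
              + ?X i * ?X j * (\<Phi> (i + j - l + m, 2) x * \<Psi> (l, 1) x
                 + \<Phi> (i + j - l, 1) x * \<Psi> (l + m, 2) x)) x"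
          by (intro has_coord_gradient_mult X A P l)
      }
    qed
    moreover have "?g m = 0" if "m \<in> {0..int n}" for m
      using pairing_coefficient_eq_0[OF that, of "\<Phi> (0, 0) x"] .
    ultimately show ?thesis
      by (rule has_coord_gradient_zeroD[where g = ?g])
  qed
  then have "pairing e n \<Phi> \<Psi> x = pairing e n \<Phi> \<Psi> y" if "x \<in> U" "y \<in> U" for x y
    using that by (rule has_derivative_zero_unique_connected[OF \<open>open U\<close> \<open>connected U\<close>])
  then show ?thesis
    unfolding constant_on_def by blast
qed

end
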